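(* Let $G$ be a finite connected graph with at least one edge and let $\Delta$ be any decision tree for $G$. Then $$T_G(x,y)=\sum_{T\text{ spanning tree of }G}x^{|\mathcal I(T)|}y^{|\mathcal E(T)|},$$ where $\mathcal I(T)$ (resp. $\mathcal E(T)$) is the set of $\Delta$-active edges of $T$ that belong to $T$ (resp. do not belong to $T$). In other words, the $\Delta$-activity is Tutte-descriptive.
   Context: Graphs are finite, loops and multiple edges allowed; $G$ has $m=|E(G)|\ge1$ edges. All subgraphs are spanning and identified with their edge sets. An isthmus is an edge whose deletion increases the number of connected components; an edge is standard if it is neither a loop nor an isthmus. $H\setminus e$ and $H/e$ denote deletion and contraction. Tutte polynomial: $T_G(x,y)=\sum_{S\subseteq E(G)}(x-1)^{c(S)-c(G)}(y-1)^{\beta(S)}$, where $c(S)$ is the number of connected components of the spanning subgraph $S$ and $\beta(S)=c(S)+|S|-|V(G)|$. A decision tree for $G$ is a perfect binary tree whose leaves are all at depth $m-1$ (root at depth $0$), each node labelled by an edge of $G$, such that along every root-to-leaf path the labels form a permutation of $E(G)$. Given a decision tree $\Delta$ and a subgraph $S$, the $\Delta$-types are assigned by: set $H:=G$, $n:=$ root of $\Delta$; for $k=1,\dots,m$ let $e_k$ be the label of $n$ and do exactly one of: (i) if $e_k$ is standard in $H$ and $e_k\notin S$: type $\mathbf S_e$, $H:=H\setminus e_k$, $n:=$ left child of $n$; (ii) if $e_k$ is a loop of $H$: type $\mathbf L$, $H:=H\setminus e_k$, $n:=$ left child; (iii) if $e_k$ is standard in $H$ and $e_k\in S$: type $\mathbf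 S_i$, $H:=H/e_k$, $n:=$ right child; (iv) if $e_k$ is an isthmus of $H$: type $\mathbf I$, $H:=H/e_k$, $n:=$ right child. An edge is $\Delta$-active for $S$ if its type is $\mathbf L$ or $\mathbf I$. *)

theory Defs
  imports Main "HOL-Library.Tree"
begin

section \<open>Graphs with loops and multiple edges\<close>

text \<open>The endpoint set of an edge is a singleton exactly when the edge is a loop.\<close>

record ('v, 'e) mgraph =
  verts :: "'v set"
  edges :: "'e set"
  ends  :: "'e \<Rightarrow> 'v set"

definition multigraph :: "('v, 'e) mgraph \<Rightarrow> bool" where
  "multigraph G \<longleftrightarrow> finite (verts G) \<and> finite (edges G) \<and>
     (\<forall>e\<in>edges G. ends G e \<subseteq> verts G \<and> (card (ends G e) = 1 \<or> card (ends G e) = 2))"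

text \<open>All subgraphs are spanning, so an edge set \<open>S\<close> determines one.\<close>

definition spanning_subgraph :: "('v, 'e) mgraph \<Rightarrow> 'e set \<Rightarrow> ('v, 'e) mgraph" where
  "spanning_subgraph G S = G\<lparr>edges := S\<rparr>"

definition adjacency :: "('v, 'e) mgraph \<Rightarrow> ('v \<times> 'v) set" where
  "adjacency G = {(u, v). \<exists>e\<in>edges G. ends G e = {u, v}}"

definition same_component :: "('v, 'e) mgraph \<Rightarrow> ('v \<times> 'v) set" where
  "same_component G = {(u, v). u \<in> verts G \<and> v \<in> verts G \<and> (u, v) \<in> (adjacency G)\<^sup>*}"

definition num_components :: "('v, 'e) mgraph \<Rightarrow> nat" where
  "num_components G = card (verts G // same_component G)"

definition connected_graph :: "('v, 'e) mgraph \<Rightarrow> bool" where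
  "connected_graph G \<longleftrightarrow> num_components G = 1"

definition delete :: "('v, 'e) mgraph \<Rightarrow> 'e \<Rightarrow> ('v, 'e) mgraph" where
  "delete G e = G\<lparr>edges := edges G - {e}\<rparr>"

text \<open>Contracting \<open>e\<close> identifies its endpoints; the merged vertex is named by an arbitrarily
  chosen endpoint of \<open>e\<close>.  An edge parallel to \<open>e\<close> becomes a loop.\<close>

definition merge_ends :: "('v, 'e) mgraph \<Rightarrow> 'e \<Rightarrow> 'v \<Rightarrow> 'v" where
  "merge_ends G e v = (if v \<in> ends G e then (SOME w. w \<in> ends G e) else v)"

definition contract :: "('v, 'e) mgraph \<Rightarrow> 'e \<Rightarrow> ('v, 'e) mgraph" where
  "contract G e = \<lparr>verts = merge_ends G e ` verts G, edges = edges G - {e},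
                   ends = (\<lambda>a. merge_ends G e ` ends G a)\<rparr>"

definition loop :: "('v, 'e) mgraph \<Rightarrow> 'e \<Rightarrow> bool" where
  "loop G e \<longleftrightarrow> e \<in> edges G \<and> card (ends G e) = 1"

definition isthmus :: "('v, 'e) mgraph \<Rightarrow> 'e \<Rightarrow> bool" where
  "isthmus G e \<longleftrightarrow> e \<in> edges G \<and> num_components G < num_components (delete G e)"

definition standard :: "('v, 'e) mgraph \<Rightarrow> 'e \<Rightarrow> bool" where
  "standard G e \<longleftrightarrow> e \<in> edges G \<and> \<not> loop G e \<and> \<not> isthmus G e"


section \<open>Spanning trees\<close>

text \<open>The cycle visits \<open>vs ! 0, vs ! 1, \<dots>\<close> and returns to \<open>vs ! 0\<close>, the edge \<open>es ! i\<close>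
  leaving \<open>vs ! i\<close>.  Loops are the cycles of length 1, pairs of parallel edges those of
  length 2.\<close>

definition is_cycle :: "('v, 'e) mgraph \<Rightarrow> 'v list \<Rightarrow> 'e list \<Rightarrow> bool" where
  "is_cycle G vs es \<longleftrightarrow> es \<noteq> [] \<and> length vs = length es \<and> distinct vs \<and> distinct es \<and>
     set es \<subseteq> edges G \<and>
     (\<forall>i<length es. ends G (es ! i) = {vs ! i, vs ! (Suc i mod length es)})"

definition spanning_tree :: "('v, 'e) mgraph \<Rightarrow> 'e set \<Rightarrow> bool" where
  "spanning_tree G T \<longleftrightarrow> T \<subseteq> edges G \<and> connected_graph (spanning_subgraph G T) \<and>
     (\<nexists>vs es. is_cycle (spanning_subgraph G T) vs es)"


section \<open>The Tutte polynomial\<close>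

text \<open>The truncated subtractions in the exponents are exact: every \<open>S \<subseteq> edges G\<close> satisfies
  \<open>c(S) \<ge> c(G)\<close> and \<open>c(S) + |S| \<ge> |V(G)|\<close>.\<close>

definition cyclomatic :: "('v, 'e) mgraph \<Rightarrow> 'e set \<Rightarrow> nat" where
  "cyclomatic G S = num_components (spanning_subgraph G S) + card S - card (verts G)"

text \<open>The polynomial is given by its values in an arbitrary commutative ring.  The indeterminates
  of \<open>\<int>[x, y]\<close> are among them, so an equation for all rings and all \<open>x\<close>, \<open>y\<close> is an equation of
  polynomials.\<close>

definition tutte :: "('v, 'e) mgraph \<Rightarrow> 'a::comm_ring_1 \<Rightarrow> 'a \<Rightarrow> 'a" where
  "tutte G x y =
     (\<Sum>S\<in>Pow (edges G).
        (x - 1) ^ (num_components (spanning_subgraph G S) - num_components G) *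
        (y - 1) ^ cyclomatic G S)"


section \<open>Decision trees and activity\<close>

text \<open>In the library's trees only the inner nodes carry labels, and the unlabelled \<open>Leaf\<close> lies below
  them.  So a labelled leaf of a decision tree is \<open>\<langle>Leaf, e, Leaf\<rangle>\<close>, and labelled leaves at depth
  \<open>m - 1\<close> amount to a complete tree of height \<open>m\<close>.\<close>

fun branches :: "'e tree \<Rightarrow> 'e list set" where
  "branches Leaf = {[]}"
| "branches (Node l e r) = (Cons e) ` (branches l \<union> branches r)"

definition decision_tree :: "('v, 'e) mgraph \<Rightarrow> 'e tree \<Rightarrow> bool" where
  "decision_tree G \<Delta> \<longleftrightarrow> complete \<Delta> \<and> height \<Delta> = card (edges G) \<and>
     (\<forall>p\<in>branches \<Delta>. distinct p \<and> set p = edges G)"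

datatype edge_type = Type_Se | Type_L | Type_Si | Type_I

text \<open>\<open>delta_type H n S\<close> runs the type assignment with current graph \<open>H\<close> from the node \<open>n\<close>
  onwards.  The last case is that of an isthmus, since the edge met belongs to \<open>H\<close>.\<close>

fun delta_type :: "('v, 'e) mgraph \<Rightarrow> 'e tree \<Rightarrow> 'e set \<Rightarrow> 'e \<rightharpoonup> edge_type" where
  "delta_type H Leaf S = Map.empty"
| "delta_type H (Node l e r) S =
     (if standard H e \<and> e \<notin> S then (delta_type (delete H e) l S)(e \<mapsto> Type_Se)
      else if loop H e then (delta_type (delete H e) l S)(e \<mapsto> Type_L)
      else if standard H e \<and> e \<in> S then (delta_type (contract H e) r S)(e \<mapsto> Type_Si)
      else (delta_type (contract H e) r S)(e \<mapsto> Type_I))"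

definition active :: "('v, 'e) mgraph \<Rightarrow> 'e tree \<Rightarrow> 'e set \<Rightarrow> 'e set" where
  "active G \<Delta> S =
     {e \<in> edges G. delta_type G \<Delta> S e = Some Type_L \<or> delta_type G \<Delta> S e = Some Type_I}"

definition internal_active :: "('v, 'e) mgraph \<Rightarrow> 'e tree \<Rightarrow> 'e set \<Rightarrow> 'e set" where
  "internal_active G \<Delta> S = active G \<Delta> S \<inter> S"

definition external_active :: "('v, 'e) mgraph \<Rightarrow> 'e tree \<Rightarrow> 'e set \<Rightarrow> 'e set" where
  "external_active G \<Delta> S = active G \<Delta> S - S"

end

theory Submission
  imports Defs
begin

text \<open>Both sides satisfy the same deletion--contraction recursion along the decision tree.  For the
  right-hand side, a spanning tree is recognised numerically as a connected edge set with
  one edge fewer than vertices, so that spanning trees avoid loops, contain isthmuses, and, for a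
  standard edge \<open>e\<close>, split into those of \<open>G \ e\<close> and those of \<open>G / e\<close>.\<close>

section \<open>Components of spanning subgraphs\<close>

text \<open>Not cut down to \<open>verts G\<close>, unlike \<open>same_component\<close>: this makes
  it an equivalence on the whole vertex type, free of membership side conditions.\<close>

definition reach :: "('v, 'e) mgraph \<Rightarrow> 'e set \<Rightarrow> ('v \<times> 'v) set" where
  "reach G S = (adjacency (spanning_subgraph G S))\<^sup>*"

abbreviation components :: "('v, 'e) mgraph \<Rightarrow> 'e set \<Rightarrow> nat" where
  "components G S \<equiv> num_components (spanning_subgraph G S)"

lemma spanning_subgraph_edges [simp]: "spanning_subgraph G (edges G) = G"
  by (simp add: spanning_subgraph_def)

lemma adjacency_spanning_subgraph:
  "adjacency (spanning_subgraph G S) = {(u, v). \<exists>e\<in>S. ends G e = {u, v}}"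
  by (simp add: adjacency_def spanning_subgraph_def)

lemma sym_adjacency: "sym (adjacency G)"
  by (auto simp: sym_def adjacency_def insert_commute)

lemma reach_refl [simp]: "(u, u) \<in> reach G S"
  by (simp add: reach_def)

lemma reach_sym: "(u, v) \<in> reach G S \<Longrightarrow> (v, u) \<in> reach G S"
  unfolding reach_def by (meson sym_adjacency sym_rtrancl symD)

lemma reach_trans: "(u, v) \<in> reach G S \<Longrightarrow> (v, w) \<in> reach G S \<Longrightarrow> (u, w) \<in> reach G S"
  by (simp add: reach_def)

lemma reach_edge: "e \<in> S \<Longrightarrow> ends G e = {u, v} \<Longrightarrow> (u, v) \<in> reach G S"
  by (auto simp: reach_def adjacency_spanning_subgraph)

lemma reach_mono: "S \<subseteq> S' \<Longrightarrow> reach G S \<subseteq> reach G S'"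
  unfolding reach_def adjacency_spanning_subgraph by (rule rtrancl_mono) auto

lemma reach_class_eq_iff: "reach G S `` {a} = reach G S `` {b} \<longleftrightarrow> (a, b) \<in> reach G S"
  by (auto intro: reach_sym reach_trans)

text \<open>Both images are \<open>A\<close> modulo the common kernel. Component counts for
  different edge sets or graphs can thus be compared through class maps on one vertex set.\<close>

lemma card_image_eq_if_same_kernel:
  assumes "\<And>a b. a \<in> A \<Longrightarrow> b \<in> A \<Longrightarrow> h a = h b \<longleftrightarrow> g a = g b"
  shows "card (h ` A) = card (g ` A)"
proof -
  \<comment> \<open>Choosing a preimage under \<open>h\<close> and applying \<open>g\<close> gives a
    bijection from \<open>h\<close> A\<open>onto\<close>g \<open>A\<close>; the choice does not
    affect the value.\<close>
  have "g (inv_into A h (h a)) = g a" if "a \<in> A" for a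
    using assms that by (meson f_inv_into_f imageI inv_into_into)
  then have im: "(\<lambda>y. g (inv_into A h y)) ` h ` A = g ` A"
    unfolding image_image by (rule image_cong[OF refl])
  have "inj_on (\<lambda>y. g (inv_into A h y)) (h ` A)"
    using assms by (intro inj_onI) (metis f_inv_into_f inv_into_into)
  from card_image[OF this] show ?thesis
    by (simp add: im)
qed

lemma components_eq_card:
  "components G S = card ((\<lambda>v. reach G S `` {v}) ` verts G)"
proof -
  let ?s = "same_component (spanning_subgraph G S)"
  have s: "?s = {(u, v). u \<in> verts G \<and> v \<in> verts G \<and> (u, v) \<in> reach G S}"
    by (simp add: same_component_def reach_def spanning_subgraph_def)
  have "components G S = card ((\<lambda>v. ?s `` {v}) ` verts G)"
    by (simp add: num_components_def quotient_def spanning_subgraph_def UNION_singleton_eq_range)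
  also have "\<dots> = card ((\<lambda>v. reach G S `` {v}) ` verts G)"
    by (rule card_image_eq_if_same_kernel)
      (auto simp: s reach_class_eq_iff intro: reach_sym reach_trans)
  finally show ?thesis .
qed

lemma components_cong:
  assumes "reach G S = reach G S'"
  shows "components G S = components G S'"
  by (simp add: components_eq_card assms)

lemma components_empty: "components G {} = card (verts G)"
proof -
  have "reach G {} = Id"
    by (simp add: reach_def adjacency_spanning_subgraph)
  then show ?thesis
    by (simp add: components_eq_card card_image)
qed

section \<open>Effect of one additional edge on the components\<close>

text \<open>A walk need cross \<open>e\<close> at most once, in one of the two directions: a second
  crossing only leads back to a side reached before.\<close>

lemma reach_insert:
  assumes "ends G e = {u, v}"
  shows "(a, b) \<in> reach G (insert e S) \<longleftrightarrow> (a, b) \<in> reach G S \<or>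
    (a, u) \<in> reach G S \<and> (v, b) \<in> reach G S \<or> (a, v) \<in> reach G S \<and> (u, b) \<in> reach G S"
    (is "_ \<longleftrightarrow> ?R b")
proof
  assume "(a, b) \<in> reach G (insert e S)"
  then show "?R b"
    unfolding reach_def[of G "insert e S"]
  proof (induction rule: rtrancl_induct)
    case base
    then show ?case by simp
  next
    case (step b c)
    from step.hyps(2) consider "ends G e = {b, c}" | f where "f \<in> S" "ends G f = {b, c}"
      by (auto simp: adjacency_spanning_subgraph)
    then show ?case
    proof cases
      case 1
      then have "b = u \<and> c = v \<or> b = v \<and> c = u"
        using assms by (auto simp: doubleton_eq_iff)
      then show ?thesis
        using step.IH by (auto intro: reach_sym reach_trans)
    next
      case 2
      then show ?thesis
        using step.IH reach_edge reach_trans by metis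
    qed
  qed
next
  have m: "reach G S \<subseteq> reach G (insert e S)"
    by (rule reach_mono) auto
  have "(u, v) \<in> reach G (insert e S)" "(v, u) \<in> reach G (insert e S)"
    using assms by (auto intro: reach_edge reach_sym)
  moreover assume "?R b"
  ultimately show "(a, b) \<in> reach G (insert e S)"
    using m by (meson reach_trans subsetD)
qed

lemma components_insert_reachable:
  assumes "ends G e = {u, v}" "(u, v) \<in> reach G S"
  shows "components G (insert e S) = components G S"
proof (rule components_cong)
  have "(a, b) \<in> reach G (insert e S) \<longleftrightarrow> (a, b) \<in> reach G S" for a b
    using reach_insert[OF assms(1)] assms(2) by (meson reach_sym reach_trans)
  then show "reach G (insert e S) = reach G S"
    by auto
qed

text \<open>The classes of \<open>u\<close> and \<open>v\<close> are distinct and fuse, while all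
  other classes stay as they are.\<close>

lemma components_insert_unreachable:
  assumes "finite (verts G)" "ends G e = {u, v}" "u \<in> verts G" "v \<in> verts G"
    and nr: "(u, v) \<notin> reach G S"
  shows "components G S = Suc (components G (insert e S))"
proof -
  define c where "c = (\<lambda>a. reach G S `` {a})"
  \<comment> \<open>Fusion is modelled by redirecting the class of \<open>v\<close> to that of
    \<open>u\<close>. The kernel of \<open>h\<close> is then reachability with \<open>e\<close>, and
    its image on the vertices loses exactly \<open>c v\<close>.\<close>
  define h where "h a = (if c a = c v then c u else c a)" for a
  have c: "c a = c b \<longleftrightarrow> (a, b) \<in> reach G S" for a b
    by (simp add: c_def reach_class_eq_iff)
  have uv: "c u \<noteq> c v"
    using nr c by simp
  have "components G (insert e S) = card (h ` verts G)"
    unfolding components_eq_card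
  proof (rule card_image_eq_if_same_kernel)
    fix a b
    show "reach G (insert e S) `` {a} = reach G (insert e S) `` {b} \<longleftrightarrow> h a = h b"
      unfolding reach_class_eq_iff reach_insert[OF assms(2)] h_def
      by (auto simp: c[symmetric])
  qed
  also have "h ` verts G = c ` verts G - {c v}"
    using assms(3,4) uv by (auto simp: h_def image_iff)
  finally have "components G (insert e S) = card (c ` verts G - {c v})" .
  moreover have "components G S = card (c ` verts G)"
    by (simp add: components_eq_card c_def)
  ultimately show ?thesis
    using assms(1,4) by (metis card_Suc_Diff1 finite_imageI imageI)
qed

lemma multigraph_ends:
  assumes "multigraph G" "e \<in> edges G"
  obtains u v where "ends G e = {u, v}" "u \<in> verts G" "v \<in> verts G"
proof -
  have "ends G e \<subseteq> verts G" "card (ends G e) = 1 \<or> card (ends G e) = 2"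
    using assms by (auto simp: multigraph_def)
  then show ?thesis
    using that by (auto simp: card_1_singleton_iff card_2_iff)
qed

lemma multigraph_finite:
  assumes "multigraph G"
  shows "finite (verts G)" "finite (edges G)" "S \<subseteq> edges G \<Longrightarrow> finite S"
  using assms by (auto simp: multigraph_def intro: finite_subset)

lemma components_insert_cases:
  assumes "multigraph G" "e \<in> edges G"
  shows "components G S = components G (insert e S) \<or>
    components G S = Suc (components G (insert e S))"
proof -
  obtain u v where "ends G e = {u, v}" "u \<in> verts G" "v \<in> verts G"
    using multigraph_ends[OF assms(1,2)] .
  then show ?thesis
    using components_insert_reachable[of G e u v S] components_insert_unreachable[of G e u v S]
      multigraph_finite(1)[OF assms(1)] by metis
qed

text \<open>Each class for \<open>S'\<close> is the \<open>S'\<close>-closure of a class for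
  \<open>S\<close>, so the classes for \<open>S'\<close> are an image of those for
  \<open>S\<close>.\<close>

lemma components_antimono:
  assumes "finite (verts G)" "S \<subseteq> S'"
  shows "components G S' \<le> components G S"
proof -
  have r: "reach G S \<subseteq> reach G S'"
    by (rule reach_mono[OF assms(2)])
  have "(\<lambda>v. reach G S' `` {v}) ` verts G = (\<lambda>X. reach G S' `` X) ` (\<lambda>v. reach G S `` {v}) ` verts G"
    unfolding image_image
  proof (rule image_cong[OF refl])
    fix v
    show "reach G S' `` {v} = reach G S' `` (reach G S `` {v})"
    proof (intro equalityI subsetI)
      fix w
      assume "w \<in> reach G S' `` {v}"
      then show "w \<in> reach G S' `` (reach G S `` {v})"
        using reach_refl[of v G S] by (meson Image_singleton_iff ImageI)
    next
      fix w
      assume "w \<in> reach G S' `` (reach G S `` {v})"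
      then show "w \<in> reach G S' `` {v}"
        using r by (auto intro: reach_trans)
    qed
  qed
  then show ?thesis
    unfolding components_eq_card using assms(1) by (simp add: card_image_le)
qed

text \<open>Without edges every vertex is a component, and each edge lowers the count by at most
  one. This makes the truncated subtraction in \<open>cyclomatic\<close> exact.\<close>

lemma card_verts_le:
  assumes "multigraph G" "S \<subseteq> edges G"
  shows "card (verts G) \<le> components G S + card S"
proof -
  have "finite S"
    using assms multigraph_finite by blast
  then show ?thesis
    using assms(2)
  proof (induction S)
    case empty
    then show ?case by (simp add: components_empty)
  next
    case (insert e S)
    then show ?case
      using components_insert_cases[OF assms(1), of e S] by auto
  qed
qed

lemma loop_components:
  assumes "loop G e"
  shows "components G (insert e S) = components G S"
proof -
  \<comment> \<open>The singleton is written as a doubleton, so that a loop is the case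
    \<open>u = v\<close> of the lemma on reachable endpoints.\<close>
  obtain v where "ends G e = {v, v}"
    using assms by (auto simp: loop_def card_1_singleton_iff)
  then show ?thesis
    using components_insert_reachable reach_refl by metis
qed

lemma num_components_delete: "num_components (delete G e) = components G (edges G - {e})"
  by (simp add: delete_def spanning_subgraph_def)

text \<open>The ends of an isthmus are separated once it is deleted, hence also within every smaller
  edge set.\<close>

lemma isthmus_components:
  assumes "multigraph G" "isthmus G e" "S \<subseteq> edges G" "e \<notin> S"
  shows "components G S = Suc (components G (insert e S))"
proof -
  have e: "e \<in> edges G" "components G (edges G) < components G (edges G - {e})"
    using assms(2) by (simp_all add: isthmus_def num_components_delete)
  obtain u v where uv: "ends G e = {u, v}" "u \<in> verts G" "v \<in> verts G"
    using multigraph_ends[OF assms(1) e(1)] .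
  \<comment> \<open>Otherwise restoring \<open>e\<close> would not change the number of
    components.\<close>
  have "(u, v) \<notin> reach G (edges G - {e})"
    using components_insert_reachable[OF uv(1)] e by (metis insert_Diff less_irrefl)
  then have "(u, v) \<notin> reach G S"
    using reach_mono[of S "edges G - {e}" G] assms by blast
  then show ?thesis
    using components_insert_unreachable uv multigraph_finite(1)[OF assms(1)] by metis
qed

section \<open>Spanning trees\<close>

text \<open>Produces a simple path, as \<open>is_cycle\<close> demands distinct vertices. The path
  is built from its far end by prepending vertices.\<close>

lemma reach_imp_path:
  assumes "(u, v) \<in> reach G S"
  shows "\<exists>vs es. length vs = Suc (length es) \<and> vs ! 0 = u \<and> vs ! length es = v \<and> distinct vs \<and>
    set es \<subseteq> S \<and> (\<forall>i<length es. ends G (es ! i) = {vs ! i, vs ! Suc i})"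
  using assms unfolding reach_def
proof (induction rule: converse_rtrancl_induct)
  case base
  show ?case
    by (intro exI[of _ "[v]"] exI[of _ "[]"]) auto
next
  case (step u w)
  from step.hyps(1) obtain a where a: "a \<in> S" "ends G a = {u, w}"
    by (auto simp: adjacency_spanning_subgraph)
  from step.IH obtain vs es where p: "length vs = Suc (length es)" "vs ! 0 = w"
    "vs ! length es = v" "distinct vs" "set es \<subseteq> S"
    "\<forall>i<length es. ends G (es ! i) = {vs ! i, vs ! Suc i}" by blast
  show ?case
  proof (cases "u \<in> set vs")
    \<comment> \<open>The new start vertex is already on the path: the closed detour before it is
      dropped.\<close>
    case True
    then obtain j where j: "j < length vs" "vs ! j = u"
      by (auto simp: in_set_conv_nth)
    have "set (drop j es) \<subseteq> S"
      using p set_drop_subset by fastforce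
    then show ?thesis
      using p j by (intro exI[of _ "drop j vs"] exI[of _ "drop j es"]) auto
  next
    case False
    then show ?thesis
      using p a by (intro exI[of _ "u # vs"] exI[of _ "a # es"]) (auto simp: nth_Cons split: nat.split)
  qed
qed

text \<open>A simple path from \<open>u\<close> to \<open>v\<close> inside \<open>S\<close> is
  closed by \<open>e\<close>. If \<open>u = v\<close>, the path is trivial and the cycle is the loop
  \<open>e\<close>.\<close>

lemma cycle_if_reach:
  assumes "ends G e = {u, v}" "e \<notin> S" "(u, v) \<in> reach G S"
  shows "\<exists>vs es. is_cycle (spanning_subgraph G (insert e S)) vs es"
proof -
  from reach_imp_path[OF assms(3)]
  obtain vs es where p: "length vs = Suc (length es)" "vs ! 0 = u"
    "vs ! length es = v" "distinct vs" "set es \<subseteq> S"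
    "\<And>i. i < length es \<Longrightarrow> ends G (es ! i) = {vs ! i, vs ! Suc i}" by blast
  \<comment> \<open>A repeated edge would have the same ends at both positions, so
    \<open>vs ! i\<close> would recur at position \<open>j\<close> or \<open>Suc j\<close>, both
    larger than \<open>i\<close>.\<close>
  have ne: "es ! i \<noteq> es ! j" if "i < j" "j < length es" for i j
  proof
    assume "es ! i = es ! j"
    then have "vs ! i \<in> {vs ! j, vs ! Suc j}"
      using p(6)[of i] p(6)[of j] that by auto
    then show False
      using p(1,4) that by (auto simp: nth_eq_iff_index_eq)
  qed
  have "distinct es"
    unfolding distinct_conv_nth by (metis ne nat_neq_iff)
  \<comment> \<open>At the last index the modulus wraps around to \<open>vs ! 0 = u\<close>, the end
    to which \<open>e\<close> returns.\<close>
  moreover have "ends G ((es @ [e]) ! i) = {vs ! i, vs ! (Suc i mod length (es @ [e]))}"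
    if "i < length (es @ [e])" for i
    using p that assms(1) by (cases "i = length es") (auto simp: nth_append)
  ultimately have "is_cycle (spanning_subgraph G (insert e S)) vs (es @ [e])"
    using p assms(2) by (auto simp: is_cycle_def spanning_subgraph_def)
  then show ?thesis by blast
qed

text \<open>The last edge of the cycle, with index \<open>n\<close>, is removed; the remaining ones
  still lead from \<open>vs ! 0\<close> to \<open>vs ! n\<close>. For a loop
  \<open>n = 0\<close>.\<close>

lemma cycle_imp_reach:
  assumes "is_cycle (spanning_subgraph G S) vs es"
  obtains e u v where "e \<in> S" "ends G e = {u, v}" "(u, v) \<in> reach G (S - {e})"
proof -
  define n where "n = length es - 1"
  have c: "length es = Suc n" "distinct es" "set es \<subseteq> S"
    "\<And>i. i < Suc n \<Longrightarrow> ends G (es ! i) = {vs ! i, vs ! (Suc i mod Suc n)}"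
    using assms by (auto simp: is_cycle_def spanning_subgraph_def n_def)
  have "i \<le> n \<Longrightarrow> (vs ! 0, vs ! i) \<in> reach G (S - {es ! n})" for i
  proof (induction i)
    case 0
    then show ?case by simp
  next
    case (Suc i)
    have "es ! i \<in> S - {es ! n}"
      using Suc.prems c(1-3) by (auto simp: nth_eq_iff_index_eq)
    moreover have "ends G (es ! i) = {vs ! i, vs ! Suc i}"
      using Suc.prems c(4)[of i] by simp
    ultimately show ?case
      using Suc reach_edge reach_trans by (metis Suc_leD)
  qed
  from reach_sym[OF this[of n]] show ?thesis
    using that[of "es ! n" "vs ! n" "vs ! 0"] c by (auto simp: subset_iff)
qed

lemma acyclic_components:
  assumes "multigraph G" "S \<subseteq> edges G"
  shows "(\<nexists>vs es. is_cycle (spanning_subgraph G S) vs es) \<longleftrightarrow>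
    components G S + card S = card (verts G)"
proof
  have "finite S"
    using assms multigraph_finite by blast
  moreover assume "\<nexists>vs es. is_cycle (spanning_subgraph G S) vs es"
  ultimately show "components G S + card S = card (verts G)"
    using assms(2)
  proof (induction S)
    case empty
    then show ?case by (simp add: components_empty)
  next
    case (insert e S)
    obtain u v where uv: "ends G e = {u, v}" "u \<in> verts G" "v \<in> verts G"
      using multigraph_ends[OF assms(1), of e] insert.prems by auto
    have "(u, v) \<notin> reach G S"
      using cycle_if_reach uv(1) insert.hyps(2) insert.prems(1) by metis
    then have "components G S = Suc (components G (insert e S))"
      using components_insert_unreachable uv multigraph_finite(1)[OF assms(1)] by metis
    moreover have "\<nexists>vs es. is_cycle (spanning_subgraph G S) vs es"
      using insert.prems(1) by (auto simp: is_cycle_def spanning_subgraph_def)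
    ultimately show ?case
      using insert by simp
  qed
next
  assume eq: "components G S + card S = card (verts G)"
  show "\<nexists>vs es. is_cycle (spanning_subgraph G S) vs es"
  proof
    assume "\<exists>vs es. is_cycle (spanning_subgraph G S) vs es"
    then obtain e u v where e: "e \<in> S" "ends G e = {u, v}" "(u, v) \<in> reach G (S - {e})"
      using cycle_imp_reach by metis
    have "components G S = components G (S - {e})"
      using components_insert_reachable[OF e(2,3)] e(1) by (simp add: insert_absorb)
    moreover have "card (verts G) \<le> components G (S - {e}) + card (S - {e})"
      using card_verts_le[OF assms(1), of "S - {e}"] assms(2) by blast
    moreover have "card (S - {e}) < card S"
      using e(1) multigraph_finite(3)[OF assms] by (meson card_Diff1_less)
    ultimately show False
      using eq by simp
  qed
qed

text \<open>Replaces cycles by counts, whose behaviour under deletion and contraction is easy to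
  follow.\<close>

lemma spanning_tree_iff:
  assumes "multigraph G"
  shows "spanning_tree G T \<longleftrightarrow>
    T \<subseteq> edges G \<and> components G T = 1 \<and> Suc (card T) = card (verts G)"
  using acyclic_components[OF assms, of T] by (auto simp: spanning_tree_def connected_graph_def)

section \<open>Deletion and contraction\<close>

lemma edges_delete [simp]: "edges (delete G e) = edges G - {e}"
  and verts_delete [simp]: "verts (delete G e) = verts G"
  and spanning_subgraph_delete [simp]:
    "spanning_subgraph (delete G e) S = spanning_subgraph G S"
  by (simp_all add: delete_def spanning_subgraph_def)

lemma edges_contract [simp]: "edges (contract G e) = edges G - {e}"
  and verts_contract: "verts (contract G e) = merge_ends G e ` verts G"
  and ends_contract: "ends (contract G e) a = merge_ends G e ` ends G a"
  by (simp_all add: contract_def)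

lemma multigraph_delete: "multigraph G \<Longrightarrow> multigraph (delete G e)"
  by (auto simp: multigraph_def delete_def)

lemma multigraph_contract:
  assumes "multigraph G"
  shows "multigraph (contract G e)"
proof -
  have "ends (contract G e) a \<subseteq> verts (contract G e) \<and>
    (card (ends (contract G e) a) = 1 \<or> card (ends (contract G e) a) = 2)"
    if a: "a \<in> edges G" for a
  proof -
    obtain u v where "ends G a = {u, v}" "u \<in> verts G" "v \<in> verts G"
      using multigraph_ends[OF assms a] .
    then show ?thesis
      by (cases "merge_ends G e u = merge_ends G e v") (auto simp: ends_contract verts_contract)
  qed
  then show ?thesis
    using assms by (auto simp: multigraph_def verts_contract)
qed

text \<open>Hides the choice operator: all that matters is that the merged vertex bears the name of
  one of the two ends.\<close>

lemma merge_ends_eq: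
  assumes "ends G e = {u, v}"
  obtains w where "w \<in> {u, v}" "\<And>a. merge_ends G e a = (if a \<in> {u, v} then w else a)"
proof
  show "(SOME w. w \<in> {u, v}) \<in> {u, v}"
    by (rule someI[of _ u]) simp
qed (simp add: merge_ends_def assms)

text \<open>Contracting \<open>e\<close> has the same effect on connectivity as making
  \<open>e\<close> available: every vertex is joined to its merged name through \<open>e\<close>,
  and conversely \<open>e\<close> collapses to a point.\<close>

lemma reach_contract:
  assumes "multigraph G" "e \<in> edges G" "S \<subseteq> edges G"
  shows "(merge_ends G e a, merge_ends G e b) \<in> reach (contract G e) S \<longleftrightarrow>
    (a, b) \<in> reach G (insert e S)"
proof -
  let ?f = "merge_ends G e"
  obtain u v where uv: "ends G e = {u, v}"
    using multigraph_ends[OF assms(1,2)] by metis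
  obtain w where w: "w \<in> {u, v}" "\<And>a. ?f a = (if a \<in> {u, v} then w else a)"
    using merge_ends_eq[OF uv] by blast
  have "(u, v) \<in> reach G (insert e S)" "(v, u) \<in> reach G (insert e S)"
    using uv by (auto intro: reach_edge reach_sym)
  then have fa: "(a, ?f a) \<in> reach G (insert e S)" for a
    using w by auto
  \<comment> \<open>Lifts one edge of the contraction to \<open>G\<close>: its ends are merged names
    of the ends of \<open>f\<close>, so \<open>f\<close> and possibly \<open>e\<close> connect
    them.\<close>
  have edge: "(c, d) \<in> reach G (insert e S)" if f: "f \<in> S" "?f ` ends G f = {c, d}" for c d f
  proof -
    obtain c' d' where cd: "ends G f = {c', d'}"
      using multigraph_ends[OF assms(1), of f] assms(3) f(1) by (metis subsetD)
    then have "(c', d') \<in> reach G (insert e S)"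
      using f(1) by (auto intro: reach_edge)
    then have "(?f c', ?f d') \<in> reach G (insert e S)"
      using fa by (meson reach_sym reach_trans)
    moreover have "{?f c', ?f d'} = {c, d}"
      using f(2) cd by simp
    ultimately show ?thesis
      by (auto simp: doubleton_eq_iff intro: reach_sym)
  qed
  show ?thesis
  proof
    assume "(?f a, ?f b) \<in> reach (contract G e) S"
    then have "(?f a, ?f b) \<in> reach G (insert e S)"
      unfolding reach_def[of "contract G e"]
    proof (induction rule: rtrancl_induct)
      case base
      then show ?case by simp
    next
      case (step c d)
      then show ?case
        using edge by (auto simp: adjacency_spanning_subgraph ends_contract intro: reach_trans)
    qed
    then show "(a, b) \<in> reach G (insert e S)"
      using fa by (meson reach_sym reach_trans)
  next
    assume "(a, b) \<in> reach G (insert e S)"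
    then show "(?f a, ?f b) \<in> reach (contract G e) S"
      unfolding reach_def[of G]
    proof (induction rule: rtrancl_induct)
      case base
      then show ?case by simp
    next
      case (step c d)
      then consider "ends G e = {c, d}" | f where "f \<in> S" "ends G f = {c, d}"
        by (auto simp: adjacency_spanning_subgraph)
      then have "(?f c, ?f d) \<in> reach (contract G e) S"
      proof cases
        case 1
        then have "?f c = ?f d" by (simp add: merge_ends_def)
        then show ?thesis by simp
      next
        case 2
        then show ?thesis
          by (intro reach_edge[of f]) (auto simp: ends_contract)
      qed
      with step.IH show ?case
        by (rule reach_trans)
    qed
  qed
qed

text \<open>The contraction may have fewer vertices, but pulled back along
  \<open>merge_ends G e\<close> its class map lives on \<open>verts G\<close> and has the same
  kernel.\<close>

lemma components_contract:
  assumes "multigraph G" "e \<in> edges G" "S \<subseteq> edges G"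
  shows "components (contract G e) S = components G (insert e S)"
  unfolding components_eq_card verts_contract image_image
  by (rule card_image_eq_if_same_kernel) (simp add: reach_class_eq_iff reach_contract[OF assms])

lemma num_components_contract:
  assumes "multigraph G" "e \<in> edges G"
  shows "num_components (contract G e) = num_components G"
  using components_contract[OF assms, of "edges G - {e}"] assms(2)
  by (metis Diff_subset edges_contract insert_Diff spanning_subgraph_edges)

lemma card_verts_contract:
  assumes "multigraph G" "e \<in> edges G" "\<not> loop G e"
  shows "card (verts G) = Suc (card (verts (contract G e)))"
proof -
  obtain u v where uv: "ends G e = {u, v}" "u \<in> verts G" "v \<in> verts G"
    using multigraph_ends[OF assms(1,2)] .
  then have "u \<noteq> v"
    using assms by (auto simp: loop_def)
  obtain w where w: "w \<in> {u, v}" "\<And>a. merge_ends G e a = (if a \<in> {u, v} then w else a)"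
    using merge_ends_eq[OF uv(1)] by blast
  \<comment> \<open>\<open>w'\<close> is the end not chosen as name, the only vertex that
    disappears.\<close>
  then obtain w' where w': "{u, v} = {w, w'}" "w \<noteq> w'"
    using \<open>u \<noteq> v\<close> by blast
  have "verts (contract G e) = verts G - {w'}"
    using w' uv by (auto simp: verts_contract w(2) image_iff doubleton_eq_iff)
  moreover have "w' \<in> {u, v}"
    using w'(1) by blast
  then have "w' \<in> verts G"
    using uv by auto
  ultimately show ?thesis
    using multigraph_finite(1)[OF assms(1)] by (metis card_Suc_Diff1)
qed

lemma not_loop_isthmus:
  assumes "loop G e"
  shows "\<not> isthmus G e"
  using loop_components[OF assms, of "edges G - {e}"] assms
  by (auto simp: isthmus_def num_components_delete loop_def insert_absorb)

lemma num_components_delete_eq: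
  assumes "multigraph G" "e \<in> edges G" "\<not> isthmus G e"
  shows "num_components (delete G e) = num_components G"
  using components_antimono[of G "edges G - {e}" "edges G"] multigraph_finite[OF assms(1)] assms
  by (auto simp: isthmus_def num_components_delete)

section \<open>Recursion for the Tutte polynomial\<close>

text \<open>Splits by membership of \<open>e\<close>; serves both the Tutte polynomial and the
  activity sum.\<close>

lemma sum_Pow_split:
  fixes f :: "'a set \<Rightarrow> 'b::comm_monoid_add"
  assumes "finite A" "e \<in> A"
  shows "sum f (Pow A) = (\<Sum>S\<in>Pow (A - {e}). f S) + (\<Sum>S\<in>Pow (A - {e}). f (insert e S))"
proof -
  have "Pow A = Pow (A - {e}) \<union> insert e ` Pow (A - {e})"
    using assms(2) by (metis Pow_insert insert_Diff)
  moreover have "inj_on (insert e) (Pow (A - {e}))"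
    by (rule inj_onI) (metis Diff_insert_absorb PowD insert_Diff_single subset_Diff_insert)
  moreover have "Pow (A - {e}) \<inter> insert e ` Pow (A - {e}) = {}"
    by auto
  ultimately show ?thesis
    using assms(1) by (simp add: sum.union_disjoint sum.reindex)
qed

lemma tutte_split:
  fixes x y :: "'a::comm_ring_1"
  assumes "multigraph G" "e \<in> edges G"
  shows "tutte G x y =
    (\<Sum>S\<in>Pow (edges G - {e}). (x - 1) ^ (components G S - num_components G) *
      (y - 1) ^ cyclomatic G S) +
    (\<Sum>S\<in>Pow (edges G - {e}). (x - 1) ^ (components G (insert e S) - num_components G) *
      (y - 1) ^ cyclomatic G (insert e S))"
  unfolding tutte_def using assms multigraph_finite(2) by (intro sum_Pow_split) auto

text \<open>Deletion leaves the subgraphs avoiding \<open>e\<close> and the vertices as they are; as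
  \<open>e\<close> is no isthmus, \<open>num_components G\<close> is kept as well.\<close>

lemma tutte_delete:
  fixes x y :: "'a::comm_ring_1"
  assumes "multigraph G" "e \<in> edges G" "\<not> isthmus G e"
  shows "(\<Sum>S\<in>Pow (edges G - {e}). (x - 1) ^ (components G S - num_components G) *
    (y - 1) ^ cyclomatic G S) = tutte (delete G e) x y"
  using num_components_delete_eq[OF assms] by (simp add: tutte_def cyclomatic_def)

text \<open>Contraction keeps the component counts and lowers both the edge count and the vertex
  count by one, so the exponents agree. Serves standard edges and isthmuses alike.\<close>

lemma tutte_contract:
  fixes x y :: "'a::comm_ring_1"
  assumes "multigraph G" "e \<in> edges G" "\<not> loop G e"
  shows "(\<Sum>S\<in>Pow (edges G - {e}). (x - 1) ^ (components G (insert e S) - num_components G) *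
    (y - 1) ^ cyclomatic G (insert e S)) = tutte (contract G e) x y"
proof -
  have "cyclomatic G (insert e S) = cyclomatic (contract G e) S"
    and "components G (insert e S) = components (contract G e) S"
    if "S \<in> Pow (edges G - {e})" for S
  proof -
    from that have S: "S \<subseteq> edges G" "e \<notin> S" "finite S"
      using multigraph_finite(3)[OF assms(1), of S] by auto
    then show "components G (insert e S) = components (contract G e) S"
      using components_contract[OF assms(1,2)] by simp
    then show "cyclomatic G (insert e S) = cyclomatic (contract G e) S"
      using S card_verts_contract[OF assms] by (simp add: cyclomatic_def)
  qed
  then show ?thesis
    using num_components_contract[OF assms(1,2)] by (simp add: tutte_def)
qed

lemma tutte_standard:
  fixes x y :: "'a::comm_ring_1"
  assumes "multigraph G" "standard G e"
  shows "tutte G x y = tutte (delete G e) x y + tutte (contract G e) x y"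
proof -
  have e: "e \<in> edges G" "\<not> loop G e" "\<not> isthmus G e"
    using assms(2) by (simp_all add: standard_def)
  show ?thesis
    unfolding tutte_split[OF assms(1) e(1)]
      tutte_delete[OF assms(1) e(1,3)] tutte_contract[OF assms(1) e(1,2)] ..
qed

text \<open>Adding the loop only raises \<open>cyclomatic\<close> by one, so the subsets with
  \<open>e\<close> contribute \<open>y - 1\<close> times what those without it do.\<close>

lemma tutte_loop:
  fixes x y :: "'a::comm_ring_1"
  assumes "multigraph G" "loop G e"
  shows "tutte G x y = y * tutte (delete G e) x y"
proof -
  have e: "e \<in> edges G"
    using assms(2) by (simp add: loop_def)
  have "cyclomatic G (insert e S) = Suc (cyclomatic G S)"
    if "S \<in> Pow (edges G - {e})" for S
  proof -
    from that have S: "S \<subseteq> edges G" "e \<notin> S" "finite S"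
      using multigraph_finite(3)[OF assms(1), of S] by auto
    then show ?thesis
      using loop_components[OF assms(2), of S] card_verts_le[OF assms(1) S(1)]
      by (simp add: cyclomatic_def)
  qed
  then have "tutte G x y = tutte (delete G e) x y + (y - 1) * tutte (delete G e) x y"
    unfolding tutte_split[OF assms(1) e]
      tutte_delete[OF assms(1) e not_loop_isthmus[OF assms(2)], symmetric]
    by (simp add: loop_components[OF assms(2)] sum_distrib_left algebra_simps)
  then show ?thesis
    by (simp add: algebra_simps)
qed

text \<open>Omitting the isthmus adds one component and leaves \<open>cyclomatic\<close> unchanged,
  so the subsets without \<open>e\<close> contribute \<open>x - 1\<close> times what those with it
  do.\<close>

lemma tutte_isthmus:
  fixes x y :: "'a::comm_ring_1"
  assumes "multigraph G" "isthmus G e"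
  shows "tutte G x y = x * tutte (contract G e) x y"
proof -
  have e: "e \<in> edges G" "\<not> loop G e"
    using assms(2) not_loop_isthmus[of G e] by (auto simp: isthmus_def)
  have "cyclomatic G S = cyclomatic G (insert e S)"
    and "components G S - num_components G =
      Suc (components G (insert e S) - num_components G)"
    if "S \<in> Pow (edges G - {e})" for S
  proof -
    from that have S: "S \<subseteq> edges G" "e \<notin> S" "finite S"
      using multigraph_finite(3)[OF assms(1), of S] by auto
    have c: "components G S = Suc (components G (insert e S))"
      using isthmus_components[OF assms S(1,2)] .
    then show "cyclomatic G S = cyclomatic G (insert e S)"
      using S by (simp add: cyclomatic_def)
    \<comment> \<open>Keeps the truncated subtraction exact, so that the successor can be pulled out
      of the exponent.\<close>
    have "num_components G \<le> components G (insert e S)"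
      using components_antimono[of G "insert e S" "edges G"] multigraph_finite(1)[OF assms(1)] S e
      by simp
    then show "components G S - num_components G =
        Suc (components G (insert e S) - num_components G)"
      using c by simp
  qed
  then have "tutte G x y = (x - 1) * tutte (contract G e) x y + tutte (contract G e) x y"
    unfolding tutte_split[OF assms(1) e(1)] tutte_contract[OF assms(1) e, symmetric]
    by (simp add: sum_distrib_left algebra_simps)
  then show ?thesis
    by (simp add: algebra_simps)
qed

section \<open>Recursion for the activity sum\<close>

lemma spanning_tree_delete:
  assumes "multigraph G" "S \<subseteq> edges G - {e}"
  shows "spanning_tree G S \<longleftrightarrow> spanning_tree (delete G e) S"
  using assms by (auto simp: spanning_tree_iff multigraph_delete)

lemma spanning_tree_contract:
  assumes "multigraph G" "e \<in> edges G" "\<not> loop G e" "S \<subseteq> edges G - {e}"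
  shows "spanning_tree G (insert e S) \<longleftrightarrow> spanning_tree (contract G e) S"
proof -
  have "S \<subseteq> edges G" "e \<notin> S" "finite S"
    using assms multigraph_finite(3)[OF assms(1), of S] by auto
  then show ?thesis
    using assms card_verts_contract[OF assms(1-3)] components_contract[OF assms(1,2), of S]
    by (auto simp: spanning_tree_iff multigraph_contract)
qed

text \<open>If \<open>insert e S\<close> is connected then so is \<open>S\<close>, which therefore
  has at least \<open>card (verts G) - 1\<close> edges; the loop is one too many.\<close>

lemma loop_not_in_spanning_tree:
  assumes "multigraph G" "loop G e" "S \<subseteq> edges G - {e}"
  shows "\<not> spanning_tree G (insert e S)"
proof -
  have "S \<subseteq> edges G" "e \<notin> S" "finite S"
    using assms multigraph_finite(3)[OF assms(1), of S] by auto
  then show ?thesis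
    using loop_components[OF assms(2), of S] card_verts_le[OF assms(1), of S]
    by (auto simp: spanning_tree_iff[OF assms(1)])
qed

text \<open>Adding \<open>e\<close> would fuse two components and leave at least one, so
  \<open>S\<close> has at least two.\<close>

lemma isthmus_in_spanning_tree:
  assumes "multigraph G" "connected_graph G" "isthmus G e" "S \<subseteq> edges G - {e}"
  shows "\<not> spanning_tree G S"
proof -
  have S: "S \<subseteq> edges G" "e \<notin> S"
    using assms by auto
  moreover have "1 \<le> components G (insert e S)"
    using components_antimono[of G "insert e S" "edges G"] multigraph_finite(1)[OF assms(1)] S assms
    by (simp add: connected_graph_def isthmus_def)
  ultimately show ?thesis
    using isthmus_components[OF assms(1,3)] by (simp add: spanning_tree_iff[OF assms(1)])
qed

section \<open>Passing to subtrees of the decision tree\<close>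

text \<open>The run consults \<open>S\<close> only about the labels of the nodes it visits. Below
  the root, \<open>insert e S\<close> may thus be replaced by \<open>S\<close>.\<close>

lemma delta_type_cong:
  assumes "S \<inter> set_tree t = S' \<inter> set_tree t"
  shows "delta_type H t S = delta_type H t S'"
  using assms
proof (induction t arbitrary: H)
  case Leaf
  then show ?case by simp
next
  case (Node l e r)
  then have "S \<inter> set_tree l = S' \<inter> set_tree l" "S \<inter> set_tree r = S' \<inter> set_tree r"
    "e \<in> S \<longleftrightarrow> e \<in> S'"
    by auto
  then show ?case
    using Node.IH by (simp add: fun_upd_def)
qed

lemma active_insert:
  assumes "e \<notin> set_tree t"
  shows "active H t (insert e S) = active H t S"
  using delta_type_cong[of "insert e S" t S H] assms by (simp add: active_def)

lemma set_tree_branches: "set_tree t = (\<Union>p\<in>branches t. set p)"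
proof (induction t)
  case (Node l e r)
  \<comment> \<open>Guarantees that the root label lies on some branch.\<close>
  have "branches l \<noteq> {}"
    by (induction l) auto
  then show ?case
    using Node by auto
qed simp

lemma branches_subtrees:
  assumes "\<forall>p\<in>branches (Node l e r). distinct p \<and> set p = E"
  shows "e \<in> E" "\<forall>p\<in>branches l. distinct p \<and> set p = E - {e}"
    "\<forall>p\<in>branches r. distinct p \<and> set p = E - {e}" "e \<notin> set_tree r"
proof -
  have *: "e \<in> E \<and> distinct p \<and> set p = E - {e}" if "p \<in> branches l \<union> branches r" for p
    using assms that by fastforce
  have "branches l \<noteq> {}"
    by (induction l) auto
  then show "e \<in> E"
    using * by blast
  show "\<forall>p\<in>branches l. distinct p \<and> set p = E - {e}" "\<forall>p\<in>branches r. distinct p \<and> set p = E - {e}"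
    using * by auto
  show "e \<notin> set_tree r"
    using * by (auto simp: set_tree_branches)
qed

text \<open>Extended by zero to all edge sets, so that the activity sum ranges over
  \<open>Pow (edges G)\<close> and splits just as \<open>tutte\<close> does.\<close>

definition activity_weight ::
  "('v, 'e) mgraph \<Rightarrow> 'e tree \<Rightarrow> 'a::comm_ring_1 \<Rightarrow> 'a \<Rightarrow> 'e set \<Rightarrow> 'a" where
  "activity_weight G \<Delta> x y T = (if spanning_tree G T
     then x ^ card (internal_active G \<Delta> T) * y ^ card (external_active G \<Delta> T) else 0)"

text \<open>\<open>T\<close> and \<open>T'\<close> need to agree on active edges only; after a
  contraction they differ by the inactive edge \<open>e\<close>.\<close>

lemma activity_weight_cong:
  assumes "active G \<Delta> T = active H \<Delta>' T'" "active H \<Delta>' T' \<inter> T = active H \<Delta>' T' \<inter> T'"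
    and "spanning_tree G T \<longleftrightarrow> spanning_tree H T'"
  shows "activity_weight G \<Delta> x y T = activity_weight H \<Delta>' x y T'"
proof -
  have "active H \<Delta>' T' - T = active H \<Delta>' T' - T'"
    using assms(2) by blast
  then show ?thesis
    using assms by (simp add: activity_weight_def internal_active_def external_active_def)
qed

text \<open>\<open>G\<close> is generalised because the subtrees act on minors of \<open>G\<close>;
  the condition on branches passes to them with \<open>edges G - {e}\<close>.\<close>

lemma tutte_eq_activity:
  fixes x y :: "'a::comm_ring_1"
  assumes "multigraph G" "connected_graph G"
    and "\<forall>p\<in>branches \<Delta>. distinct p \<and> set p = edges G"
  shows "tutte G x y = (\<Sum>T\<in>Pow (edges G). activity_weight G \<Delta> x y T)"
  using assms
proof (induction \<Delta> arbitrary: G)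
  case Leaf
  then have E: "edges G = {}"
    by simp
  \<comment> \<open>A connected graph without edges has a single vertex; on both sides only the
    empty set contributes, with value 1.\<close>
  have 1: "components G {} = 1" "num_components G = 1"
    using Leaf(2) spanning_subgraph_edges[of G] by (simp_all add: E connected_graph_def)
  then have "card (verts G) = 1"
    by (simp add: components_empty)
  with 1 E show ?case
    by (simp add: tutte_def cyclomatic_def activity_weight_def internal_active_def
        external_active_def active_def spanning_tree_iff[OF Leaf(1)])
next
  case (Node l e r)
  note G = Node.prems(1)
  note br = branches_subtrees[OF Node.prems(3)]
  let ?E = "Pow (edges G - {e})" and ?\<Delta> = "Node l e r"
  let ?D = "delete G e" and ?C = "contract G e"
  \<comment> \<open>Restricted to non-isthmuses, whose deletion keeps the graph connected;
    contraction always does.\<close>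
  have D: "tutte ?D x y = (\<Sum>T\<in>?E. activity_weight ?D l x y T)" if "\<not> isthmus G e"
    using Node.IH(1)[of ?D] multigraph_delete[OF G] br num_components_delete_eq[OF G br(1) that]
      Node.prems(2) by (simp add: connected_graph_def)
  have C: "tutte ?C x y = (\<Sum>T\<in>?E. activity_weight ?C r x y T)"
    using Node.IH(2)[of ?C] multigraph_contract[OF G] br num_components_contract[OF G br(1)]
      Node.prems(2) by (simp add: connected_graph_def)
  \<comment> \<open>Since \<open>e\<close> is no edge of either minor, inserting it into an active
    set raises the cardinality by exactly one.\<close>
  have e: "e \<notin> active ?D t S" "e \<notin> active ?C t S" for t S
    by (auto simp: active_def)
  have fin: "finite (active ?D t S)" "finite (active ?C t S)" for t S
    using multigraph_finite(2)[OF G] by (auto simp: active_def)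
  have split: "(\<Sum>T\<in>Pow (edges G). activity_weight G ?\<Delta> x y T) =
    (\<Sum>T\<in>?E. activity_weight G ?\<Delta> x y T) + (\<Sum>T\<in>?E. activity_weight G ?\<Delta> x y (insert e T))"
    using sum_Pow_split[OF multigraph_finite(2)[OF G] br(1)] .
  consider "standard G e" | "loop G e" | "isthmus G e"
    using br(1) by (auto simp: standard_def)
  then show ?case
  proof cases
    case 1
    then have ni: "\<not> isthmus G e" "\<not> loop G e"
      by (auto simp: standard_def)
    have "activity_weight G ?\<Delta> x y T = activity_weight ?D l x y T" if T: "T \<in> ?E" for T
    proof -
      have "active G ?\<Delta> T = active ?D l T"
        using 1 T by (auto simp: active_def)
      then show ?thesis
        using spanning_tree_delete[OF G] T by (intro activity_weight_cong) auto
    qed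
    moreover have "activity_weight G ?\<Delta> x y (insert e T) = activity_weight ?C r x y T"
      if T: "T \<in> ?E" for T
    proof -
      \<comment> \<open>The root gives \<open>e\<close> the inactive type \<open>Type_Si\<close>,
        and \<open>e\<close> does not occur in \<open>r\<close>.\<close>
      have "active G ?\<Delta> (insert e T) = active ?C r T"
        using 1 ni active_insert[OF br(4), of ?C T] by (auto simp: active_def)
      then show ?thesis
        using spanning_tree_contract[OF G br(1) ni(2)] T e
        by (intro activity_weight_cong) auto
    qed
    ultimately show ?thesis
      by (simp add: split tutte_standard[OF G 1] D[OF ni(1)] C)
  next
    case 2
    have "activity_weight G ?\<Delta> x y T = y * activity_weight ?D l x y T" if T: "T \<in> ?E" for T
    proof -
      \<comment> \<open>The loop is active and outside \<open>T\<close>, which yields one factor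
        \<open>y\<close>.\<close>
      have "active G ?\<Delta> T = insert e (active ?D l T)"
        using 2 br(1) by (auto simp: active_def standard_def)
      then have "internal_active G ?\<Delta> T = internal_active ?D l T"
        "external_active G ?\<Delta> T = insert e (external_active ?D l T)"
        using T by (auto simp: internal_active_def external_active_def)
      then show ?thesis
        using spanning_tree_delete[OF G, of T e] T e fin
        by (simp add: activity_weight_def external_active_def)
    qed
    moreover have "activity_weight G ?\<Delta> x y (insert e T) = 0" if T: "T \<in> ?E" for T
      using loop_not_in_spanning_tree[OF G 2, of T] T by (simp add: activity_weight_def)
    ultimately show ?thesis
      by (simp add: split tutte_loop[OF G 2] D[OF not_loop_isthmus[OF 2]] sum_distrib_left)
  next
    case 3
    then have nl: "\<not> loop G e"
      using not_loop_isthmus[of G e] by blast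
    have "activity_weight G ?\<Delta> x y (insert e T) = x * activity_weight ?C r x y T"
      if T: "T \<in> ?E" for T
    proof -
      \<comment> \<open>The isthmus is active and inside the tree, which yields one factor
        \<open>x\<close>.\<close>
      have "active G ?\<Delta> (insert e T) = insert e (active ?C r T)"
        using 3 br(1) nl active_insert[OF br(4), of ?C T]
        by (auto simp: active_def standard_def)
      then have "internal_active G ?\<Delta> (insert e T) = insert e (internal_active ?C r T)"
        "external_active G ?\<Delta> (insert e T) = external_active ?C r T"
        using e by (auto simp: internal_active_def external_active_def)
      then show ?thesis
        using spanning_tree_contract[OF G br(1) nl, of T] T e fin
        by (simp add: activity_weight_def internal_active_def)
    qed
    moreover have "activity_weight G ?\<Delta> x y T = 0" if T: "T \<in> ?E" for T
      using isthmus_in_spanning_tree[OF G Node.prems(2) 3, of T] T by (simp add: activity_weight_def)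
    ultimately show ?thesis
      by (simp add: split tutte_isthmus[OF G 3] C sum_distrib_left)
  qed
qed

theorem theorem4p1:
  fixes G :: "('v, 'e) mgraph" and \<Delta> :: "'e tree" and x y :: "'a::comm_ring_1"
  assumes "multigraph G" and "connected_graph G" and "edges G \<noteq> {}"
    and "decision_tree G \<Delta>"
  shows "tutte G x y =
    (\<Sum>T\<in>{T. spanning_tree G T}.
       x ^ card (internal_active G \<Delta> T) * y ^ card (external_active G \<Delta> T))"
proof -
  have "{T. spanning_tree G T} = {T \<in> Pow (edges G). spanning_tree G T}"
    by (auto simp: spanning_tree_def)
  moreover have "finite (Pow (edges G))"
    using multigraph_finite(2)[OF assms(1)] by simp
  moreover have "tutte G x y = (\<Sum>T\<in>Pow (edges G). activity_weight G \<Delta> x y T)"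
    using tutte_eq_activity[of G \<Delta> x y] assms by (simp add: decision_tree_def)
  ultimately show ?thesis
    \<comment> \<open>Summing the zero-extended weight over all subsets is summing over the spanning
      trees alone.\<close>
    by (simp only: activity_weight_def sum.inter_filter)
qed

end
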